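(* Let $\mathbf{P}=(P_1,\ldots,P_n)^\top:\mathbb{R}^n\to\mathbb{R}^n$ be a polynomial map, where each $P_i$ is a homogeneous polynomial of degree $d\ge1$ with nonnegative coefficients. Assume that $\mathbf{P}$ is weakly primitive. Let $\psi\in\mathbb{R}^n$ be a vector with all coordinates positive. Let $\mathbf{F}=(F_1,\ldots,F_n)^\top$ with $F_i(\mathbf{x})=(P_i(\mathbf{x}))^{1/d}$ for $\mathbf{x}\in\mathbb{R}_+^n$, let $\mathbf{x}^{(0)}$ be an arbitrary vector in $\operatorname{int}\mathbb{R}_+^n$, and define inductively $$\mathbf{x}^{(k+1)}=\big(\psi^\top\mathbf{F}(\mathbf{x}^{(k)})\big)^{-1}\mathbf{F}(\mathbf{x}^{(k)}),\qquad k=0,1,2,\ldots$$ Let $\lambda$ be the unique scalar for which there is a vector $\mathbf{u}\in\operatorname{int}\mathbb{R}_+^n$ with $P_i(\mathbf{u})=\lambda u_i^d$ for all $i\in[n]$. Then the sequence $\mathbf{x}^{(k)}$ converges to the unique vector $\mathbf{u}\in\operatorname{int}\mathbb{R}_+^n$ satisfying $P_i(\mathbf{u})=\lambda u_i^d$ for $i\in[n]$ and $\psi^\top\mathbf{u}=1$.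
   Context: $[n]=\{1,\ldots,n\}$; $\operatorname{int}\mathbb{R}_+^n$ is the set of vectors with all coordinates positive. The di-graph $G(\mathbf{P})$ (for $P_i$ homogeneous) has vertex set $[n]$, and $(i,j)$ is a di-edge if and only if the variable $x_j$ effectively appears in $P_i$ (in a monomial with nonzero coefficient). $\mathbf{P}$ is weakly primitive if $G(\mathbf{P})$ is strongly connected and the gcd of the lengths of its circuits (directed cycles, loops included) is equal to one. (The existence and uniqueness of $\lambda$ is part of the result.) *)

theory Defs
  imports "HOL-Analysis.Analysis" "HOL-Library.Poly_Mapping" "Graph_Theory.Graph_Theory"
begin

text \<open>Real polynomials in variables indexed by \<^typ>\<open>'n\<close>: finitely supported maps from monomials
  (exponent vectors) to coefficients. The keys of such a map are the monomials with nonzero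
  coefficient.\<close>

type_synonym 'n mvpoly = "('n \<Rightarrow>\<^sub>0 nat) \<Rightarrow>\<^sub>0 real"

definition mv_eval :: "'n::finite mvpoly \<Rightarrow> real ^ 'n \<Rightarrow> real" where
  "mv_eval p x =
     (\<Sum>m\<in>Poly_Mapping.keys p.
        Poly_Mapping.lookup p m * (\<Prod>j\<in>UNIV. (x $ j) ^ Poly_Mapping.lookup m j))"

definition homogeneous :: "nat \<Rightarrow> 'n::finite mvpoly \<Rightarrow> bool" where
  "homogeneous d p \<longleftrightarrow>
     (\<forall>m\<in>Poly_Mapping.keys p. (\<Sum>j\<in>UNIV. Poly_Mapping.lookup m j) = d)"

definition nonneg_coeffs :: "'n mvpoly \<Rightarrow> bool" where
  "nonneg_coeffs p \<longleftrightarrow> (\<forall>m. 0 \<le> Poly_Mapping.lookup p m)"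

definition appears_in :: "'n \<Rightarrow> 'n mvpoly \<Rightarrow> bool" where
  "appears_in j p \<longleftrightarrow> (\<exists>m\<in>Poly_Mapping.keys p. Poly_Mapping.lookup m j \<noteq> 0)"

definition poly_digraph :: "('n \<Rightarrow> 'n mvpoly) \<Rightarrow> 'n pair_pre_digraph" where
  "poly_digraph P = \<lparr> pverts = UNIV, parcs = {(i, j). appears_in j (P i)} \<rparr>"

text \<open>Cycles are nonempty arc lists; loops are cycles of length one. If there are no cycles,
  the gcd is 0 and weak primitivity fails.\<close>

definition weakly_primitive :: "('n \<Rightarrow> 'n mvpoly) \<Rightarrow> bool" where
  "weakly_primitive P \<longleftrightarrow>
     strongly_connected (with_proj (poly_digraph P)) \<and>
     Gcd {length c |c. pre_digraph.cycle (with_proj (poly_digraph P)) c} = (1::nat)"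

definition pos_vec :: "real ^ 'n \<Rightarrow> bool" where
  "pos_vec x \<longleftrightarrow> (\<forall>i. 0 < x $ i)"

definition root_map :: "nat \<Rightarrow> ('n::finite \<Rightarrow> 'n mvpoly) \<Rightarrow> real ^ 'n \<Rightarrow> real ^ 'n" where
  "root_map d P x = (\<chi> i. root d (mv_eval (P i) x))"

definition eigenpair :: "nat \<Rightarrow> ('n::finite \<Rightarrow> 'n mvpoly) \<Rightarrow> real \<Rightarrow> real ^ 'n \<Rightarrow> bool" where
  "eigenpair d P l u \<longleftrightarrow> (\<forall>i. mv_eval (P i) u = l * (u $ i) ^ d)"

end

theory Submission
  imports Defs
begin

text \<open>Write \<open>F\<close> for the root map and \<open>M(x) = max\<^sub>i F\<^sub>i(x) / x\<^sub>i\<close>. Since \<open>F\<close> is monotone and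
  homogeneous of degree one, \<open>M\<close> does not increase along the normalized orbit. A bound
  \<open>F(x) \<le> c x\<close>, propagated along the arcs of the strongly connected digraph, bounds all ratios
  \<open>x\<^sub>j / x\<^sub>i\<close>, so the orbit stays in a compact subset of the open cone. Weak primitivity gives an
  \<open>N\<close> such that all pairs of vertices are joined by a walk of length exactly \<open>N\<close>, whence
  \<open>F\<^sup>N\<close> is strictly increasing in every coordinate; therefore \<open>M(F\<^sup>N u) < M(u)\<close> unless \<open>u\<close> is
  an eigenvector. As \<open>M\<close> is constant on the cluster points of the orbit, these are eigenvectors,
  and the same strictness makes the normalized positive eigenvector unique.\<close>

subsection \<open>Walks in strongly connected aperiodic digraphs\<close>

lemma add_closed_Gcd_1_imp_eventually:
  fixes A :: "nat set"
  assumes zero: "0 \<in> A" and add: "\<And>a b. a \<in> A \<Longrightarrow> b \<in> A \<Longrightarrow> a + b \<in> A" and gcd: "Gcd A = 1"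
  shows "\<forall>\<^sub>F n in sequentially. n \<in> A"
proof -
  have mult: "k * a \<in> A" if "a \<in> A" for k a
    using that zero add by (induction k) auto
  \<comment> \<open>The least difference \<open>g > 0\<close> of two elements of \<open>A\<close> divides all of \<open>A\<close>, so it is \<open>1\<close> and \<open>A\<close> contains
    two consecutive numbers.\<close>
  define D where "D = (\<lambda>g. 0 < g \<and> (\<exists>b\<in>A. b + g \<in> A))"
  have "\<not> A \<subseteq> {0}" using gcd by (metis Gcd_0_iff zero_neq_one)
  then obtain a0 where "a0 \<in> A" "a0 > 0" by auto
  then have "D a0" using zero unfolding D_def by force
  define g where "g = (LEAST g. D g)"
  have "D g" unfolding g_def using \<open>D a0\<close> by (rule LeastI)
  then obtain b where b: "g > 0" "b \<in> A" "b + g \<in> A" unfolding D_def by auto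
  have "g dvd c" if "c \<in> A" for c
  proof (rule ccontr)
    assume "\<not> g dvd c"
    then have "0 < c mod g" by (simp add: dvd_eq_mod_eq_0)
    define q where "q = c div g"
    \<comment> \<open>The elements \<open>c + q * b\<close> and \<open>q * (b + g)\<close> of
      \<open>A\<close> differ by \<open>c mod g\<close>, a positive difference smaller than
      \<open>g\<close>.\<close>
    have "c mod g + q * (b + g) = c + q * b"
      unfolding q_def using div_mult_mod_eq[of c g] by (simp add: algebra_simps)
    moreover have "c + q * b \<in> A" "q * (b + g) \<in> A" using that b mult add by auto
    ultimately have "D (c mod g)" unfolding D_def using \<open>0 < c mod g\<close>
      by (metis add.commute)
    then have "g \<le> c mod g" unfolding g_def by (rule Least_le)
    then show False using mod_less_divisor[OF \<open>g > 0\<close>, of c] by linarith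
  qed
  then have "g dvd Gcd A" by (rule Gcd_greatest)
  then have bs: "b + 1 \<in> A" using gcd b by auto
  \<comment> \<open>With \<open>n = q * b + r\<close> and \<open>r < b\<close>, the threshold forces
    \<open>b \<le> q\<close>, hence \<open>r \<le> q\<close>, and
    \<open>n = (q - r) * b + r * (b + 1)\<close> combines the two consecutive elements. If
    \<open>b = 0\<close>, then \<open>1\<close> itself lies in \<open>A\<close>.\<close>
  have "n \<in> A" if "n \<ge> b * b + b" for n
  proof (cases "b = 0")
    case True
    then show ?thesis using mult[OF bs, of n] by simp
  next
    case False
    have "b \<le> n div b" using that False
      by (metis add_leD1 div_le_mono nonzero_mult_div_cancel_right)
    then have le: "n mod b \<le> n div b" using False by (meson le_trans less_imp_le mod_less_divisor neq0_conv)
    have "n = (n div b - n mod b) * b + n mod b * (b + 1)"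
      using le div_mult_mod_eq[of n b] by (simp add: algebra_simps diff_mult_distrib)
    then show ?thesis using mult[OF b(2)] mult[OF bs] add by metis
  qed
  then show ?thesis unfolding eventually_sequentially by blast
qed

lemma relpow_compose:
  assumes "(u, v) \<in> E ^^ a" "(v, w) \<in> E ^^ b"
  shows "(u, w) \<in> E ^^ (a + b)"
  using assms by (auto simp: relpow_add)

text \<open>The lengths of closed walks at one vertex \<open>v\<close> are closed under addition.
  Their gcd divides each \<open>c\<close> in \<open>C\<close>, because a closed walk of length
  \<open>c\<close> can be inserted into a closed walk from \<open>v\<close>. So all large lengths
  occur at \<open>v\<close>; walks to and from \<open>v\<close> carry this over to every pair, and
  there are finitely many pairs.\<close>

lemma strongly_connected_aperiodic_imp_relpow_UNIV:
  fixes E :: "('n::finite \<times> 'n) set"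
  assumes conn: "\<And>u v. (u, v) \<in> E\<^sup>*"
    and gcd: "Gcd C = (1::nat)" and C: "\<And>c. c \<in> C \<Longrightarrow> \<exists>u. (u, u) \<in> E ^^ c"
  shows "\<exists>N. E ^^ N = UNIV"
proof -
  obtain v :: 'n where True by blast
  have walk: "\<exists>k. (a, b) \<in> E ^^ k" for a b using conn rtrancl_power by metis
  define A where "A = {k. (v, v) \<in> E ^^ k}"
  have "Gcd A dvd c" if c: "c \<in> C" for c
  proof -
    obtain w where w: "(w, w) \<in> E ^^ c" using C c by blast
    obtain a b where ab: "(v, w) \<in> E ^^ a" "(w, v) \<in> E ^^ b" using walk by meson
    have "a + b \<in> A" "a + c + b \<in> A" unfolding A_def
      using relpow_compose[OF ab] relpow_compose[OF relpow_compose[OF ab(1) w] ab(2)] by simp_all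
    then have "Gcd A dvd a + b" "Gcd A dvd (a + b) + c"
      by (auto intro!: Gcd_dvd simp: ac_simps)
    then show ?thesis using dvd_add_right_iff by blast
  qed
  then have "Gcd A dvd Gcd C" by (rule Gcd_greatest)
  then have "Gcd A = 1" using gcd by simp
  then have ev: "\<forall>\<^sub>F n in sequentially. n \<in> A"
    by (intro add_closed_Gcd_1_imp_eventually) (auto simp: A_def intro: relpow_compose)
  have "\<forall>\<^sub>F n in sequentially. p \<in> E ^^ n" for p
  proof -
    obtain i j where p: "p = (i, j)" by force
    obtain a b where ab: "(i, v) \<in> E ^^ a" "(v, j) \<in> E ^^ b" using walk by meson
    obtain n0 where n0: "\<And>n. n \<ge> n0 \<Longrightarrow> n \<in> A" using ev unfolding eventually_sequentially by blast
    have "(i, j) \<in> E ^^ n" if "n \<ge> a + n0 + b" for n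
    proof -
      have "(v, v) \<in> E ^^ (n - a - b)" using n0[of "n - a - b"] that by (simp add: A_def)
      from relpow_compose[OF relpow_compose[OF ab(1) this] ab(2)]
      show ?thesis using that by simp
    qed
    then show ?thesis unfolding eventually_sequentially p by blast
  qed
  then have "\<forall>\<^sub>F n in sequentially. \<forall>p. p \<in> E ^^ n" by (rule eventually_all_finite)
  then show ?thesis unfolding eventually_sequentially by blast
qed

text \<open>Passes from digraphs to powers of the arc relation: a cycle is in particular a closed
  walk of the same length.\<close>

lemma weakly_primitive_imp_relpow_UNIV:
  fixes P :: "'n::finite \<Rightarrow> 'n mvpoly"
  assumes "weakly_primitive P"
  shows "\<exists>N. {(i, j). appears_in j (P i)} ^^ N = UNIV"
proof (rule strongly_connected_aperiodic_imp_relpow_UNIV)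
  let ?E = "{(i, j). appears_in j (P i)}" and ?G = "with_proj (poly_digraph P)"
  let ?C = "{length c |c. pre_digraph.cycle ?G c}"
  show "(u, v) \<in> ?E\<^sup>*" for u v
  proof -
    have "(u, v) \<in> rtrancl_on (verts ?G) (arcs_ends ?G)"
      using assms unfolding weakly_primitive_def strongly_connected_def reachable_def
      by (auto simp: poly_digraph_def)
    then show ?thesis
      by induction (auto simp: arcs_ends_def arc_to_ends_def poly_digraph_def
          intro: rtrancl_into_rtrancl converse_rtrancl_into_rtrancl)
  qed
  show "Gcd ?C = 1" using assms unfolding weakly_primitive_def by blast
  have walk: "pre_digraph.cas ?G u p v \<Longrightarrow> set p \<subseteq> arcs ?G \<Longrightarrow> (u, v) \<in> ?E ^^ length p" for u p v
  proof (induction p arbitrary: u)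
    case Nil
    then show ?case by (simp add: pre_digraph.cas.simps)
  next
    case (Cons e p)
    then have "(snd e, v) \<in> ?E ^^ length p" "(u, snd e) \<in> ?E"
      by (auto simp: pre_digraph.cas.simps poly_digraph_def)
    then show ?case by (metis length_Cons relpow_Suc_I2)
  qed
  show "\<exists>u. (u, u) \<in> ?E ^^ c" if "c \<in> ?C" for c
    using that walk unfolding pre_digraph.cycle_def pre_digraph.awalk_def by blast
qed

subsection \<open>Power iteration for monotone homogeneous maps\<close>

lemma pos_vec_scaleR: "t > 0 \<Longrightarrow> pos_vec x \<Longrightarrow> pos_vec (t *\<^sub>R x)"
  unfolding pos_vec_def by simp

lemma inner_vec_pos: "pos_vec x \<Longrightarrow> pos_vec y \<Longrightarrow> x \<bullet> y > 0"
  unfolding pos_vec_def inner_vec_def by (auto intro!: sum_pos)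

text \<open>Here \<open>t\<close> is the largest coordinate ratio, so the multiple
  \<open>t *\<^sub>R v\<close> touches \<open>u\<close> from above at \<open>i\<close>.\<close>

lemma obtain_max_ratio:
  fixes u v :: "real ^ 'n::finite"
  assumes "pos_vec u" "pos_vec v"
  obtains t i where "t > 0" "u \<le> t *\<^sub>R v" "u $ i = t * v $ i"
proof -
  let ?r = "\<lambda>i. u $ i / v $ i"
  have v: "v $ i > 0" and u: "u $ i > 0" for i using assms by (auto simp: pos_vec_def)
  have "Max (range ?r) \<in> range ?r" by (intro Max_in) auto
  then obtain i where i: "?r i = Max (range ?r)" by force
  have "?r k \<le> ?r i" for k unfolding i by (intro Max_ge) auto
  then have "u \<le> ?r i *\<^sub>R v" unfolding less_eq_vec_def using v by (auto simp: pos_divide_le_eq)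
  moreover have "u $ i = ?r i * v $ i" using v[of i] by simp
  ultimately show ?thesis using that u v divide_pos_pos by blast
qed

text \<open>Collects what the convergence argument uses of the root map. Along an arc
  \<open>(i, j)\<close>, \<open>F x $ i\<close> strictly follows an increase of \<open>x $ j\<close>
  (\<open>strict\<close>) and cannot stay bounded while \<open>x $ j\<close> grows and all
  coordinates are at least 1 (\<open>growth\<close>).\<close>

locale primitive_homogeneous_map =
  fixes F :: "real ^ 'n::finite \<Rightarrow> real ^ 'n" and E :: "('n \<times> 'n) set" and N :: nat
  assumes pos: "pos_vec x \<Longrightarrow> pos_vec (F x)"
    and mono: "pos_vec x \<Longrightarrow> x \<le> y \<Longrightarrow> F x \<le> F y"
    and strict: "pos_vec x \<Longrightarrow> x \<le> y \<Longrightarrow> (i, j) \<in> E \<Longrightarrow> x $ j < y $ j \<Longrightarrow> F x $ i < F y $ i"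
    and hom: "pos_vec x \<Longrightarrow> t > 0 \<Longrightarrow> F (t *\<^sub>R x) = t *\<^sub>R F x"
    and cont: "continuous_on {x. pos_vec x} F"
    and growth: "(i, j) \<in> E \<Longrightarrow> \<exists>B. \<forall>x. (\<forall>k. 1 \<le> x $ k) \<longrightarrow> F x $ i \<le> A \<longrightarrow> x $ j \<le> B"
    and walks: "E ^^ N = UNIV"
begin

section \<open>Iterates and their strict monotonicity\<close>

lemma pos_iter: "pos_vec x \<Longrightarrow> pos_vec ((F ^^ m) x)"
  by (induction m) (auto intro: pos)

lemma hom_iter: "pos_vec x \<Longrightarrow> t > 0 \<Longrightarrow> (F ^^ m) (t *\<^sub>R x) = t *\<^sub>R (F ^^ m) x"
  by (induction m) (auto simp: hom pos_iter)

lemma cont_iter: "continuous_on {x. pos_vec x} (F ^^ m)"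
proof (induction m)
  case 0
  then show ?case by (simp add: id_def continuous_on_id)
next
  case (Suc m)
  show ?case unfolding funpow.simps
    by (intro continuous_on_compose Suc continuous_on_subset[OF cont]) (auto intro: pos_iter)
qed

text \<open>A strict increase travels backwards along the walk: one application of \<open>F\<close>
  moves it from \<open>j\<close> to the vertex before \<open>j\<close>.\<close>

lemma strict_iter:
  assumes "pos_vec x" "x \<le> y" "(i, j) \<in> E ^^ m" "x $ j < y $ j"
  shows "(F ^^ m) x $ i < (F ^^ m) y $ i"
  using assms
proof (induction m arbitrary: x y j)
  case 0
  then show ?case by simp
next
  case (Suc m)
  then obtain k where k: "(i, k) \<in> E ^^ m" "(k, j) \<in> E" by auto
  have "(F ^^ m) (F x) $ i < (F ^^ m) (F y) $ i"
    using Suc k by (intro Suc.IH[of _ _ k]) (auto intro: pos mono strict)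
  then show ?case by (simp add: funpow_swap1)
qed

lemma strict_everywhere:
  assumes "pos_vec x" "x \<le> y" "x \<noteq> y"
  shows "(F ^^ N) x $ i < (F ^^ N) y $ i"
proof -
  obtain j where "x $ j \<noteq> y $ j" using assms by (metis vec_eq_iff)
  then have "x $ j < y $ j" using assms by (simp add: less_eq_vec_def less_le)
  then show ?thesis using assms walks by (intro strict_iter) auto
qed

text \<open>\<open>F ^^ N\<close> turns the non-strict inequality
  \<open>F u \<le> c *\<^sub>R u\<close> into one that is strict in every coordinate, and it
  commutes with \<open>F\<close> and with the scalar.\<close>

lemma subeigenvector_strict_iter:
  assumes "pos_vec u" "F u \<le> c *\<^sub>R u" "F u \<noteq> c *\<^sub>R u" "c > 0"
  shows "F ((F ^^ N) u) $ i < c * (F ^^ N) u $ i"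
proof -
  have "(F ^^ N) (F u) $ i < (F ^^ N) (c *\<^sub>R u) $ i"
    using assms by (intro strict_everywhere pos)
  then show ?thesis using assms by (simp add: hom_iter funpow_swap1)
qed

section \<open>Uniqueness of positive eigenvectors\<close>

lemma eigenvector_iter:
  assumes "pos_vec u" "F u = a *\<^sub>R u" "a > 0"
  shows "(F ^^ m) u = a ^ m *\<^sub>R u"
  using assms by (induction m) (auto simp: hom pos_vec_scaleR)

lemma eigenvalue_pos:
  assumes "pos_vec u" "F u = a *\<^sub>R u"
  shows "a > 0"
proof -
  have "0 < F u $ i" "0 < u $ i" for i using assms(1) pos[OF assms(1)] unfolding pos_vec_def by blast+
  then have "0 < a * u $ i" "0 < u $ i" for i using assms(2) by simp_all
  then show ?thesis by (rule zero_less_mult_pos2)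
qed

text \<open>Take the multiple of \<open>v\<close> that touches \<open>u\<close> from above at
  \<open>i\<close>. If it differs from \<open>u\<close>, applying \<open>F ^^ N\<close> separates
  them strictly at \<open>i\<close> too, which gives \<open>a ^ N < b ^ N\<close>.\<close>

lemma eigenvector_compare:
  assumes u: "pos_vec u" "F u = a *\<^sub>R u" and v: "pos_vec v" "F v = b *\<^sub>R v"
  shows "a < b \<or> (a = b \<and> (\<exists>t. u = t *\<^sub>R v))"
proof -
  obtain t i where t: "t > 0" "u \<le> t *\<^sub>R v" "u $ i = t * v $ i"
    using obtain_max_ratio[OF u(1) v(1)] by metis
  have ab: "a > 0" "b > 0" using u v eigenvalue_pos by auto
  have ui: "u $ i > 0" using u by (simp add: pos_vec_def)
  show ?thesis
  proof (cases "u = t *\<^sub>R v")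
    case True
    then have "a *\<^sub>R u = t *\<^sub>R (b *\<^sub>R v)" using u(2) v(2) hom[OF v(1) t(1)] by metis
    also have "\<dots> = b *\<^sub>R u" unfolding True by simp
    finally have "a *\<^sub>R u = b *\<^sub>R u" .
    then have "(a *\<^sub>R u) $ i = (b *\<^sub>R u) $ i" by (rule arg_cong)
    then have "a = b" using ui by simp
    then show ?thesis using True by blast
  next
    case False
    have "(F ^^ N) u $ i < (F ^^ N) (t *\<^sub>R v) $ i"
      using t u False by (intro strict_everywhere)
    then have "a ^ N * u $ i < t * (b ^ N * v $ i)"
      using eigenvector_iter[OF u ab(1)] eigenvector_iter[OF v ab(2)] hom_iter[OF v(1) t(1)] by simp
    also have "\<dots> = b ^ N * u $ i" using t(3) by simp
    finally have "a ^ N < b ^ N" using ui by simp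
    then show ?thesis using ab by (meson less_imp_le power_less_imp_less_base)
  qed
qed

lemma eigenvector_unique:
  assumes "pos_vec u" "F u = a *\<^sub>R u" "pos_vec v" "F v = b *\<^sub>R v"
  shows "a = b" "\<psi> \<bullet> u = 1 \<Longrightarrow> \<psi> \<bullet> v = 1 \<Longrightarrow> u = v"
proof -
  \<comment> \<open>Comparison in both orders rules out \<open>a < b\<close> and
    \<open>b < a\<close>; the normalization by \<open>\<psi>\<close> then forces the factor
    1.\<close>
  have *: "a = b \<and> (\<exists>t. u = t *\<^sub>R v)"
    using eigenvector_compare[OF assms] eigenvector_compare[OF assms(3,4,1,2)] by auto
  then show "a = b" by simp
  show "u = v" if "\<psi> \<bullet> u = 1" "\<psi> \<bullet> v = 1" using * that by auto
qed

section \<open>Bounded coordinate ratios of subeigenvectors\<close>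

lemma subeigenvector_ratio_bound_walk:
  assumes "(i, j) \<in> E ^^ m"
  shows "\<exists>B. \<forall>x. (\<forall>k. 1 \<le> x $ k) \<longrightarrow> F x \<le> c *\<^sub>R x \<longrightarrow> x $ i \<le> 1 \<longrightarrow> x $ j \<le> B"
  using assms
proof (induction m arbitrary: j)
  case 0
  then show ?case by auto
next
  case (Suc m)
  then obtain k where k: "(i, k) \<in> E ^^ m" "(k, j) \<in> E" by auto
  \<comment> \<open>A bound on \<open>x $ k\<close> bounds \<open>F x $ k\<close> by the
    subeigenvector inequality, and \<open>growth\<close> turns that into a bound on
    \<open>x $ j\<close>. The absolute value admits \<open>c\<close> of either sign.\<close>
  from Suc.IH[OF k(1)] obtain B
    where B: "\<And>x. (\<forall>k. 1 \<le> x $ k) \<Longrightarrow> F x \<le> c *\<^sub>R x \<Longrightarrow> x $ i \<le> 1 \<Longrightarrow> x $ k \<le> B" by blast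
  from growth[OF k(2), of "\<bar>c\<bar> * B"] obtain B'
    where B': "\<And>x. (\<forall>k. 1 \<le> x $ k) \<Longrightarrow> F x $ k \<le> \<bar>c\<bar> * B \<Longrightarrow> x $ j \<le> B'" by blast
  have "x $ j \<le> B'" if x: "\<forall>k. 1 \<le> x $ k" "F x \<le> c *\<^sub>R x" "x $ i \<le> 1" for x
  proof (rule B'[OF x(1)])
    have "F x $ k \<le> c * x $ k" using x(2) by (simp add: less_eq_vec_def)
    also have "\<dots> \<le> \<bar>c\<bar> * x $ k" using x(1) by (intro mult_right_mono) (auto intro: order_trans[of 0 1])
    also have "\<dots> \<le> \<bar>c\<bar> * B" using B[OF x] by (intro mult_left_mono) auto
    finally show "F x $ k \<le> \<bar>c\<bar> * B" .
  qed
  then show ?case by blast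
qed

text \<open>By homogeneity \<open>x\<close> may be scaled to have least coordinate 1. A walk from a
  vertex where the minimum is attained then bounds every other coordinate.\<close>

lemma subeigenvector_ratio_bound:
  "\<exists>B\<ge>1. \<forall>x i j. pos_vec x \<longrightarrow> F x \<le> c *\<^sub>R x \<longrightarrow> x $ j \<le> B * x $ i"
proof -
  have "\<forall>p. \<exists>B. \<forall>x. (\<forall>k. 1 \<le> x $ k) \<longrightarrow> F x \<le> c *\<^sub>R x \<longrightarrow> x $ (fst p) \<le> 1 \<longrightarrow> x $ (snd p) \<le> B"
    using subeigenvector_ratio_bound_walk walks by (metis UNIV_I)
  then obtain b where b: "\<And>p x. (\<forall>k. 1 \<le> x $ k) \<Longrightarrow> F x \<le> c *\<^sub>R x \<Longrightarrow> x $ (fst p) \<le> 1 \<Longrightarrow> x $ (snd p) \<le> b p"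
    by metis
  \<comment> \<open>Including 1 keeps \<open>B\<close> positive, for later use as a factor and a
    divisor.\<close>
  define B where "B = Max (insert 1 (range b))"
  have B: "b p \<le> B" "1 \<le> B" for p unfolding B_def by (intro Max_ge; simp)+
  have "x $ j \<le> B * x $ i" if x: "pos_vec x" "F x \<le> c *\<^sub>R x" for x i j
  proof -
    have xp: "x $ k > 0" for k using x by (simp add: pos_vec_def)
    define \<mu> where "\<mu> = Min (range (($) x))"
    have "\<mu> \<in> range (($) x)" unfolding \<mu>_def by (intro Min_in) auto
    then obtain m where m: "\<mu> = x $ m" by auto
    have le: "\<mu> \<le> x $ k" for k unfolding \<mu>_def by (intro Min_le) auto
    have mp: "\<mu> > 0" using xp m by simp
    let ?y = "inverse \<mu> *\<^sub>R x"
    have "?y $ (snd (m, j)) \<le> b (m, j)"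
    proof (rule b)
      show "\<forall>k. 1 \<le> ?y $ k" using le mp by (simp add: field_simps)
      have "F ?y = inverse \<mu> *\<^sub>R F x" using x mp by (simp add: hom)
      also have "\<dots> \<le> c *\<^sub>R ?y" using x(2) mp by (simp add: less_eq_vec_def field_simps)
      finally show "F ?y \<le> c *\<^sub>R ?y" .
      show "?y $ (fst (m, j)) \<le> 1" using m mp by simp
    qed
    also have "\<dots> \<le> B" by (rule B)
    finally have "x $ j \<le> B * \<mu>" using mp by (simp add: field_simps)
    also have "\<dots> \<le> B * x $ i" using le B(2) by (intro mult_left_mono) auto
    finally show ?thesis .
  qed
  then show ?thesis using B(2) by blast
qed

text \<open>The upper Collatz-Wielandt quotient, called \<open>M\<close> in the overview: the least
  \<open>c\<close> with \<open>F x \<le> c *\<^sub>R x\<close>.\<close>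

definition upper_growth :: "real ^ 'n \<Rightarrow> real" where
  "upper_growth x = Max (range (\<lambda>i. F x $ i / x $ i))"

lemma upper_growth_le_iff:
  assumes "pos_vec x"
  shows "upper_growth x \<le> c \<longleftrightarrow> F x \<le> c *\<^sub>R x"
proof -
  have "x $ i > 0" for i using assms by (simp add: pos_vec_def)
  then show ?thesis unfolding upper_growth_def by (simp add: less_eq_vec_def pos_divide_le_eq)
qed

lemma upper_growth_less_iff:
  assumes "pos_vec x"
  shows "upper_growth x < c \<longleftrightarrow> (\<forall>i. F x $ i < c * x $ i)"
proof -
  have "x $ i > 0" for i using assms by (simp add: pos_vec_def)
  then show ?thesis unfolding upper_growth_def by (simp add: pos_divide_less_eq)
qed

lemma upper_growth_scaleR:
  assumes "pos_vec x" "t > 0"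
  shows "upper_growth (t *\<^sub>R x) = upper_growth x"
  using assms unfolding upper_growth_def by (simp add: hom)

lemma upper_growth_pos:
  assumes "pos_vec x"
  shows "upper_growth x > 0"
proof (rule ccontr)
  assume "\<not> ?thesis"
  then have "F x \<le> 0 *\<^sub>R x" using upper_growth_le_iff[OF assms, of 0] by simp
  then show False using pos[OF assms] by (auto simp: less_eq_vec_def pos_vec_def not_less[symmetric])
qed

text \<open>Applying the monotone homogeneous \<open>F\<close> to
  \<open>F x \<le> c *\<^sub>R x\<close> gives the same inequality for \<open>F x\<close>.\<close>

lemma upper_growth_step:
  assumes "pos_vec x"
  shows "upper_growth (F x) \<le> upper_growth x"
proof -
  have "F x \<le> upper_growth x *\<^sub>R x" using assms upper_growth_le_iff by blast
  then have "F (F x) \<le> F (upper_growth x *\<^sub>R x)" using assms by (intro mono pos)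
  then show ?thesis using assms by (simp add: upper_growth_le_iff pos hom upper_growth_pos)
qed

section \<open>Convergence of a normalized orbit\<close>

context
  fixes \<psi> :: "real ^ 'n" and y :: "nat \<Rightarrow> real ^ 'n"
  assumes psi: "pos_vec \<psi>"
    and y_pos: "\<And>k. pos_vec (y k)"
    and y_norm: "\<And>k. \<psi> \<bullet> y k = 1"
    and y_step: "\<And>k. \<exists>s>0. y (Suc k) = s *\<^sub>R F (y k)"
begin

lemma orbit_iter: "\<exists>s>0. y (k + m) = s *\<^sub>R (F ^^ m) (y k)"
proof (induction m)
  case 0
  then show ?case by (intro exI[of _ 1]) simp
next
  case (Suc m)
  then obtain s where s: "s > 0" "y (k + m) = s *\<^sub>R (F ^^ m) (y k)" by blast
  obtain r where r: "r > 0" "y (Suc (k + m)) = r *\<^sub>R F (y (k + m))" using y_step by blast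
  have "y (k + Suc m) = (r * s) *\<^sub>R (F ^^ Suc m) (y k)"
    using r s by (simp add: hom pos_iter y_pos)
  then show ?case using r s by (metis mult_pos_pos)
qed

lemma decseq_upper_growth: "decseq (\<lambda>k. upper_growth (y k))"
proof (rule decseq_SucI)
  fix k
  obtain s where "s > 0" "y (Suc k) = s *\<^sub>R F (y k)" using y_step by blast
  then show "upper_growth (y (Suc k)) \<le> upper_growth (y k)"
    using upper_growth_step[OF y_pos] by (simp add: upper_growth_scaleR pos y_pos)
qed

text \<open>Since the growth does not increase, the ratio bound for
  \<open>c = upper_growth (y 0)\<close> serves the whole orbit; with the normalization it confines
  the orbit to a box inside the open cone.\<close>

lemma orbit_in_compact:
  obtains K where "compact K" "K \<subseteq> {x. pos_vec x}" "\<And>k. y k \<in> K"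
proof -
  define c where "c = upper_growth (y 0)"
  obtain B where B: "B \<ge> 1" "\<And>x i j. pos_vec x \<Longrightarrow> F x \<le> c *\<^sub>R x \<Longrightarrow> x $ j \<le> B * x $ i"
    using subeigenvector_ratio_bound[of c] by blast
  have sub: "F (y k) \<le> c *\<^sub>R y k" for k
    using decseqD[OF decseq_upper_growth, of 0 k] upper_growth_le_iff[OF y_pos] by (simp add: c_def)
  define S where "S = (\<Sum>i\<in>UNIV. \<psi> $ i)"
  have psip: "\<psi> $ i > 0" for i using psi by (simp add: pos_vec_def)
  have S: "S > 0" unfolding S_def using psip by (intro sum_pos) auto
  have norm: "(\<Sum>j\<in>UNIV. \<psi> $ j * y k $ j) = 1" for k using y_norm[of k] by (simp add: inner_vec_def)
  \<comment> \<open>Averaging the ratio bounds with weights \<open>\<psi>\<close> gives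
    \<open>1 \<le> y k $ i * (B * S)\<close> and \<open>y k $ i * S \<le> B\<close>.\<close>
  let ?K = "cbox (\<chi> i. 1 / (B * S)) ((\<chi> i. B / S) :: real ^ 'n)"
  have "y k \<in> ?K" for k
  proof -
    have "1 / (B * S) \<le> y k $ i" for i
    proof -
      have "1 \<le> (\<Sum>j\<in>UNIV. \<psi> $ j * (B * y k $ i))"
        unfolding norm[of k, symmetric]
        using psip B(2)[OF y_pos sub] by (intro sum_mono mult_left_mono) (auto intro: less_imp_le)
      also have "\<dots> = y k $ i * (B * S)"
        unfolding S_def sum_distrib_left sum_distrib_right by (simp add: mult_ac)
      finally show ?thesis using B(1) S by (simp add: pos_divide_le_eq)
    qed
    moreover have "y k $ i \<le> B / S" for i
    proof -
      have "y k $ i * S = (\<Sum>j\<in>UNIV. \<psi> $ j * y k $ i)"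
        unfolding S_def sum_distrib_left by (simp add: mult_ac)
      also have "\<dots> \<le> (\<Sum>j\<in>UNIV. \<psi> $ j * (B * y k $ j))"
        using psip B(2)[OF y_pos sub] by (intro sum_mono mult_left_mono) (auto intro: less_imp_le)
      also have "\<dots> = B * (\<Sum>j\<in>UNIV. \<psi> $ j * y k $ j)"
        by (simp add: sum_distrib_left mult_ac)
      finally show ?thesis using S norm by (simp add: pos_le_divide_eq)
    qed
    ultimately show ?thesis by (simp add: mem_box_cart)
  qed
  moreover have "?K \<subseteq> {x. pos_vec x}"
  proof
    fix x assume x: "x \<in> ?K"
    have "0 < 1 / (B * S)" using B S by simp
    moreover have "1 / (B * S) \<le> x $ i" for i using x by (simp add: mem_box_cart)
    ultimately show "x \<in> {x. pos_vec x}" unfolding pos_vec_def mem_Collect_eq by (meson less_le_trans)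
  qed
  ultimately show ?thesis using that[of ?K] compact_cbox by blast
qed

text \<open>The growth along the orbit decreases to some \<open>c\<close>, so
  \<open>F u \<le> c *\<^sub>R u\<close> in the limit. If equality failed, \<open>F ^^ N\<close>
  would make the inequality strict at \<open>u\<close> and, by continuity, at some
  \<open>y (r k)\<close>. As \<open>y (r k + N)\<close> is a positive multiple of
  \<open>(F ^^ N) (y (r k))\<close>, its growth would fall below \<open>c\<close>.\<close>

lemma cluster_point_eigenvector:
  assumes r: "strict_mono r" and lim: "(\<lambda>k. y (r k)) \<longlonglongrightarrow> u" and u: "pos_vec u"
  shows "\<exists>c>0. F u = c *\<^sub>R u" "\<psi> \<bullet> u = 1"
proof -
  let ?a = "\<lambda>k. upper_growth (y k)"
  have "(\<lambda>k. \<psi> \<bullet> y (r k)) \<longlonglongrightarrow> \<psi> \<bullet> u" using lim by (intro tendsto_intros)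
  then show "\<psi> \<bullet> u = 1" by (simp add: y_norm LIMSEQ_const_iff)
  obtain c where c: "?a \<longlonglongrightarrow> c" "\<And>k. c \<le> ?a k"
    using decseq_convergent[OF decseq_upper_growth, of 0] upper_growth_pos[OF y_pos] less_imp_le
    by metis
  have Flim: "(\<lambda>k. F (y (r k))) \<longlonglongrightarrow> F u"
    using cont lim u y_pos by (intro continuous_on_tendsto_compose[OF cont lim]) auto
  have arlim: "(\<lambda>k. ?a (r k)) \<longlonglongrightarrow> c" using LIMSEQ_subseq_LIMSEQ[OF c(1) r] by (simp add: o_def)
  have sub: "F u \<le> c *\<^sub>R u" unfolding less_eq_vec_def
  proof
    fix i
    have "F (y k) $ i \<le> ?a k * y k $ i" for k
      using upper_growth_le_iff[OF y_pos, of k "?a k"] by (simp add: less_eq_vec_def)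
    moreover have "(\<lambda>k. F (y (r k)) $ i) \<longlonglongrightarrow> F u $ i" using Flim by (intro tendsto_intros)
    moreover have "(\<lambda>k. ?a (r k) * y (r k) $ i) \<longlonglongrightarrow> c * u $ i"
      using arlim lim by (intro tendsto_intros)
    ultimately show "F u $ i \<le> (c *\<^sub>R u) $ i" by (auto intro: LIMSEQ_le)
  qed
  \<comment> \<open>A limit of positive numbers is only known to be nonnegative; positivity comes
    from \<open>upper_growth u \<le> c\<close>.\<close>
  have cpos: "c > 0"
    using upper_growth_pos[OF u] sub upper_growth_le_iff[OF u] by (meson less_le_trans)
  have "F u = c *\<^sub>R u"
  proof (rule ccontr)
    assume ne: "F u \<noteq> c *\<^sub>R u"
    let ?G = "F ^^ N"
    have Glim: "(\<lambda>k. ?G (y (r k))) \<longlonglongrightarrow> ?G u"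
      using u y_pos by (intro continuous_on_tendsto_compose[OF cont_iter lim]) auto
    have FGlim: "(\<lambda>k. F (?G (y (r k)))) \<longlonglongrightarrow> F (?G u)"
      using u y_pos by (intro continuous_on_tendsto_compose[OF cont Glim]) (simp_all add: pos_iter)
    have "\<forall>\<^sub>F k in sequentially. F (?G (y (r k))) $ i < c * ?G (y (r k)) $ i" for i
    proof -
      have "(\<lambda>k. c * ?G (y (r k)) $ i - F (?G (y (r k))) $ i)
          \<longlonglongrightarrow> c * ?G u $ i - F (?G u) $ i"
        using Glim FGlim by (intro tendsto_intros)
      moreover have "c * ?G u $ i - F (?G u) $ i > 0"
        using subeigenvector_strict_iter[OF u sub ne cpos] by simp
      ultimately have "\<forall>\<^sub>F k in sequentially. 0 < c * ?G (y (r k)) $ i - F (?G (y (r k))) $ i"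
        by (rule order_tendstoD)
      then show ?thesis by simp
    qed
    then have "\<forall>\<^sub>F k in sequentially. \<forall>i. F (?G (y (r k))) $ i < c * ?G (y (r k)) $ i"
      by (rule eventually_all_finite)
    then obtain k where "\<forall>i. F (?G (y (r k))) $ i < c * ?G (y (r k)) $ i"
      unfolding eventually_sequentially by blast
    then have "upper_growth (?G (y (r k))) < c"
      by (simp add: upper_growth_less_iff pos_iter y_pos)
    moreover obtain s where "s > 0" "y (r k + N) = s *\<^sub>R ?G (y (r k))" using orbit_iter by blast
    ultimately have "?a (r k + N) < c" by (simp add: upper_growth_scaleR pos_iter y_pos)
    then show False using c(2) by (simp add: not_le[symmetric])
  qed
  then show "\<exists>c>0. F u = c *\<^sub>R u" using cpos by blast
qed

lemma normalized_orbit_converges: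
  "\<exists>u c. pos_vec u \<and> c > 0 \<and> F u = c *\<^sub>R u \<and> \<psi> \<bullet> u = 1 \<and> y \<longlonglongrightarrow> u"
proof -
  obtain K where K: "compact K" "K \<subseteq> {x. pos_vec x}" "\<And>k. y k \<in> K"
    using orbit_in_compact by metis
  \<comment> \<open>Stated for an arbitrary subsequence \<open>q\<close>: the identity yields
    existence of \<open>u\<close>, and a subsequence staying away from \<open>u\<close> would yield
    a second normalized eigenvector.\<close>
  have cluster: "\<exists>u r. strict_mono r \<and> (\<lambda>k. y (q (r k))) \<longlonglongrightarrow> u \<and> pos_vec u \<and> \<psi> \<bullet> u = 1 \<and>
      (\<exists>c>0. F u = c *\<^sub>R u)" if q: "strict_mono q" for q :: "nat \<Rightarrow> nat"
  proof -
    have "\<forall>k. (y \<circ> q) k \<in> K" using K by simp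
    then obtain u r where ur: "u \<in> K" "strict_mono r" "((y \<circ> q) \<circ> r) \<longlonglongrightarrow> u"
      using seq_compactE[OF compact_imp_seq_compact[OF K(1)], of "y \<circ> q"] by metis
    have lim: "(\<lambda>k. y ((q \<circ> r) k)) \<longlonglongrightarrow> u" using ur by (simp add: o_def)
    have u: "pos_vec u" using ur K by blast
    show ?thesis
      using cluster_point_eigenvector[OF strict_mono_o[OF q ur(2)] lim u] u ur(2) lim unfolding o_def by blast
  qed
  obtain u c where u: "pos_vec u" "\<psi> \<bullet> u = 1" "c > 0" "F u = c *\<^sub>R u"
    using cluster[OF strict_mono_id] by metis
  have "y \<longlonglongrightarrow> u"
  proof (rule ccontr)
    assume "\<not> y \<longlonglongrightarrow> u"
    then obtain e where e: "e > 0" "\<not> (\<forall>\<^sub>F k in sequentially. dist (y k) u < e)"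
      unfolding tendsto_iff by blast
    obtain q :: "nat \<Rightarrow> nat" where q: "strict_mono q" "\<And>k. \<not> dist (y (q k)) u < e"
      using not_eventually_sequentiallyD[OF e(2)] by metis
    obtain v r where v: "(\<lambda>k. y (q (r k))) \<longlonglongrightarrow> v" "pos_vec v" "\<psi> \<bullet> v = 1" "\<exists>c>0. F v = c *\<^sub>R v"
      using cluster[OF q(1)] by metis
    then have "v = u" using u eigenvector_unique(2) by metis
    then have "\<forall>\<^sub>F k in sequentially. dist (y (q (r k))) u < e" using tendstoD[OF v(1) e(1)] by simp
    then show False using q(2) by simp
  qed
  then show ?thesis using u by blast
qed

end

end

subsection \<open>Homogeneous polynomials with nonnegative coefficients\<close>

lemma prod_mono_strict_factor:
  fixes f g :: "'a \<Rightarrow> real"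
  assumes "finite A" "j \<in> A" "\<And>i. i \<in> A \<Longrightarrow> 0 < f i" "\<And>i. i \<in> A \<Longrightarrow> f i \<le> g i" "f j < g j"
  shows "prod f A < prod g A"
proof -
  have "f j * prod f (A - {j}) < g j * prod f (A - {j})"
    using assms by (intro mult_strict_right_mono prod_pos) auto
  also have "\<dots> \<le> g j * prod g (A - {j})"
    using assms by (intro mult_left_mono prod_mono) (auto intro: less_imp_le less_trans)
  finally show ?thesis using assms by (simp add: prod.remove)
qed

lemma mv_eval_mono:
  assumes "nonneg_coeffs p" "pos_vec x" "x \<le> y"
  shows "mv_eval p x \<le> mv_eval p y"
proof -
  have "0 \<le> x $ i" "x $ i \<le> y $ i" for i
    using assms by (auto simp: pos_vec_def less_eq_vec_def intro: less_imp_le)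
  then show ?thesis using assms unfolding mv_eval_def
    by (intro sum_mono mult_left_mono prod_mono conjI power_mono) (auto simp: nonneg_coeffs_def)
qed

lemma coeff_pos: "nonneg_coeffs p \<Longrightarrow> m \<in> Poly_Mapping.keys p \<Longrightarrow> 0 < Poly_Mapping.lookup p m"
  unfolding nonneg_coeffs_def in_keys_iff by (simp add: less_le)

text \<open>A monomial containing the variable \<open>j\<close> increases strictly because its other
  factors are positive; the remaining monomials do not decrease.\<close>

lemma mv_eval_strict_mono:
  assumes "nonneg_coeffs p" "pos_vec x" "x \<le> y" "appears_in j p" "x $ j < y $ j"
  shows "mv_eval p x < mv_eval p y"
proof -
  obtain m where m: "m \<in> Poly_Mapping.keys p" "Poly_Mapping.lookup m j \<noteq> 0"
    using assms by (auto simp: appears_in_def)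
  have x: "0 < x $ i" "x $ i \<le> y $ i" for i
    using assms by (auto simp: pos_vec_def less_eq_vec_def)
  have "(\<Prod>i\<in>UNIV. x $ i ^ Poly_Mapping.lookup m i) < (\<Prod>i\<in>UNIV. y $ i ^ Poly_Mapping.lookup m i)"
    using x m assms(5)
    by (intro prod_mono_strict_factor[of _ j]) (auto intro: power_mono power_strict_mono less_imp_le)
  then show ?thesis unfolding mv_eval_def using x m assms(1)
    by (intro sum_strict_mono_ex1 ballI mult_left_mono prod_mono bexI[of _ m] mult_strict_left_mono)
       (auto simp: nonneg_coeffs_def coeff_pos intro!: power_mono intro: less_imp_le)
qed

lemma mv_eval_nonneg: "nonneg_coeffs p \<Longrightarrow> pos_vec x \<Longrightarrow> 0 \<le> mv_eval p x"
  unfolding mv_eval_def nonneg_coeffs_def pos_vec_def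
  by (intro sum_nonneg mult_nonneg_nonneg prod_nonneg) (auto intro: less_imp_le)

text \<open>The value at \<open>x\<close> strictly exceeds the nonnegative value at half of
  \<open>x\<close>.\<close>

lemma mv_eval_pos:
  assumes "nonneg_coeffs p" "pos_vec x" "appears_in j p"
  shows "0 < mv_eval p x"
proof -
  have "pos_vec ((1 / 2) *\<^sub>R x)" "(1 / 2) *\<^sub>R x \<le> x" "((1 / 2) *\<^sub>R x) $ j < x $ j"
    using assms by (auto simp: pos_vec_def less_eq_vec_def intro: less_imp_le)
  then have "mv_eval p ((1 / 2) *\<^sub>R x) < mv_eval p x"
    using assms by (intro mv_eval_strict_mono)
  then show ?thesis using mv_eval_nonneg \<open>pos_vec ((1 / 2) *\<^sub>R x)\<close> assms(1) le_less_trans by blast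
qed

lemma mv_eval_scaleR:
  assumes "homogeneous d p"
  shows "mv_eval p (t *\<^sub>R x) = t ^ d * mv_eval p x"
  unfolding mv_eval_def sum_distrib_left
proof (rule sum.cong[OF refl])
  fix m assume "m \<in> Poly_Mapping.keys p"
  then have "(\<Prod>j\<in>UNIV. t ^ Poly_Mapping.lookup m j) = t ^ d"
    using assms power_sum[of t "Poly_Mapping.lookup m" UNIV] by (simp add: homogeneous_def)
  then show "Poly_Mapping.lookup p m * (\<Prod>j\<in>UNIV. (t *\<^sub>R x) $ j ^ Poly_Mapping.lookup m j) =
      t ^ d * (Poly_Mapping.lookup p m * (\<Prod>j\<in>UNIV. x $ j ^ Poly_Mapping.lookup m j))"
    by (simp add: power_mult_distrib prod.distrib)
qed

text \<open>Where all coordinates are at least 1, a monomial containing the variable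
  \<open>j\<close> is at least \<open>x $ j\<close>; its coefficient serves as \<open>c\<close>.
  This supplies \<open>growth\<close>.\<close>

lemma mv_eval_ge_linear:
  assumes "nonneg_coeffs p" "appears_in j p"
  shows "\<exists>c>0. \<forall>x. (\<forall>k. 1 \<le> x $ k) \<longrightarrow> c * x $ j \<le> mv_eval p x"
proof -
  obtain m where m: "m \<in> Poly_Mapping.keys p" "Poly_Mapping.lookup m j \<noteq> 0"
    using assms by (auto simp: appears_in_def)
  have "Poly_Mapping.lookup p m * x $ j \<le> mv_eval p x" if x: "\<forall>k. 1 \<le> x $ k" for x
  proof -
    let ?q = "\<lambda>m. \<Prod>i\<in>UNIV. x $ i ^ Poly_Mapping.lookup m i"
    have x0: "0 \<le> x $ k" for k using x by (meson order_trans zero_le_one)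
    have "x $ j \<le> x $ j ^ Poly_Mapping.lookup m j" using x m by (intro self_le_power) auto
    also have "\<dots> * 1 \<le> x $ j ^ Poly_Mapping.lookup m j * (\<Prod>i\<in>UNIV - {j}. x $ i ^ Poly_Mapping.lookup m i)"
      using x x0 by (intro mult_left_mono prod_ge_1) auto
    also have "\<dots> = ?q m" by (simp add: prod.remove)
    finally have "x $ j \<le> ?q m" by simp
    then have "Poly_Mapping.lookup p m * x $ j \<le> Poly_Mapping.lookup p m * ?q m"
      using coeff_pos[OF assms(1) m(1)] by (intro mult_left_mono) auto
    also have "\<dots> \<le> mv_eval p x" unfolding mv_eval_def using m x0 assms(1)
      by (intro member_le_sum mult_nonneg_nonneg prod_nonneg) (auto simp: nonneg_coeffs_def)
    finally show ?thesis .
  qed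
  then show ?thesis using coeff_pos[OF assms(1) m(1)] by blast
qed

lemma continuous_on_mv_eval: "continuous_on S (mv_eval p)"
  unfolding mv_eval_def by (intro continuous_intros)

text \<open>For \<open>d \<ge> 1\<close>, \<open>root d\<close> is injective and multiplicative on
  all reals, negative ones included, so \<open>l\<close> may have any sign.\<close>

lemma eigenpair_iff_root_map:
  assumes "d \<ge> 1" "pos_vec u"
  shows "eigenpair d P l u \<longleftrightarrow> root_map d P u = root d l *\<^sub>R u"
proof -
  have "root d (l * u $ i ^ d) = root d l * u $ i" for i
    using assms by (simp add: pos_vec_def real_root_mult real_root_power_cancel less_imp_le)
  then have "mv_eval (P i) u = l * u $ i ^ d \<longleftrightarrow> root d (mv_eval (P i) u) = root d l * u $ i" for i
    using assms(1) by (metis less_le_trans zero_less_one real_root_eq_iff)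
  then show ?thesis by (simp add: eigenpair_def root_map_def vec_eq_iff)
qed

lemma root_map_primitive_homogeneous:
  fixes P :: "'n::finite \<Rightarrow> 'n mvpoly"
  assumes d: "d \<ge> 1" and hom: "\<And>i. homogeneous d (P i)" and nonneg: "\<And>i. nonneg_coeffs (P i)"
    and walks: "{(i, j). appears_in j (P i)} ^^ N = UNIV"
    and vars: "\<And>i. \<exists>j. appears_in j (P i)"
  shows "primitive_homogeneous_map (root_map d P) {(i, j). appears_in j (P i)} N"
proof
  have d0: "d > 0" using d by simp
  show "pos_vec (root_map d P x)" if "pos_vec x" for x
    unfolding pos_vec_def
  proof
    fix i
    obtain j where "appears_in j (P i)" using vars by blast
    then have "0 < mv_eval (P i) x" by (rule mv_eval_pos[OF nonneg that])
    then show "0 < root_map d P x $ i" using d0 by (simp add: root_map_def)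
  qed
  show "root_map d P x \<le> root_map d P y" if "pos_vec x" "x \<le> y" for x y
    using that nonneg d0 by (simp add: root_map_def less_eq_vec_def[of "vec_lambda _"] mv_eval_mono)
  show "root_map d P x $ i < root_map d P y $ i"
    if "pos_vec x" "x \<le> y" "(i, j) \<in> {(i, j). appears_in j (P i)}" "x $ j < y $ j" for x y i j
    using mv_eval_strict_mono[OF nonneg that(1,2) _ that(4)] that(3) d0 by (simp add: root_map_def)
  show "root_map d P (t *\<^sub>R x) = t *\<^sub>R root_map d P x" if "t > 0" for x t
    using that d0
    by (simp add: root_map_def vec_eq_iff mv_eval_scaleR[OF hom] real_root_mult real_root_power_cancel)
  show "continuous_on {x. pos_vec x} (root_map d P)"
    unfolding root_map_def by (intro continuous_intros continuous_on_mv_eval)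
  show "\<exists>B. \<forall>x. (\<forall>k. 1 \<le> x $ k) \<longrightarrow> root_map d P x $ i \<le> A \<longrightarrow> x $ j \<le> B"
    if ij: "(i, j) \<in> {(i, j). appears_in j (P i)}" for i j A
  proof -
    obtain c where c: "c > 0" "\<And>x. \<forall>k. 1 \<le> x $ k \<Longrightarrow> c * x $ j \<le> mv_eval (P i) x"
      using mv_eval_ge_linear[OF nonneg] ij by blast
    \<comment> \<open>Raising \<open>F x $ i \<le> A\<close> to the power \<open>d\<close> bounds
      the polynomial by \<open>A ^ d\<close>, which is compared with its linear lower bound.\<close>
    have "x $ j \<le> A ^ d / c" if x: "\<forall>k. 1 \<le> x $ k" "root_map d P x $ i \<le> A" for x
    proof -
      have "pos_vec x" unfolding pos_vec_def using x(1) by (meson less_le_trans zero_less_one)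
      then have p: "0 \<le> mv_eval (P i) x" using mv_eval_nonneg nonneg by blast
      have "c * x $ j \<le> mv_eval (P i) x" using c(2) x(1) .
      also have "\<dots> = root d (mv_eval (P i) x) ^ d" using d0 p by simp
      also have "\<dots> \<le> A ^ d" using x(2) p d0 by (intro power_mono) (auto simp: root_map_def)
      finally show ?thesis using c(1) by (simp add: pos_le_divide_eq mult.commute)
    qed
    then show ?thesis by blast
  qed
qed (fact walks)

section \<open>Convergence of the normalized power iteration for the polynomial map\<close>

theorem corollary5p1:
  fixes P :: "'n::finite \<Rightarrow> 'n mvpoly"
    and d :: nat
    and \<psi> :: "real ^ 'n"
    and x :: "nat \<Rightarrow> real ^ 'n"
  assumes "d \<ge> 1"
    and "\<And>i. homogeneous d (P i)"
    and "\<And>i. nonneg_coeffs (P i)"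
    and "weakly_primitive P"
    and "pos_vec \<psi>"
    and "pos_vec (x 0)"
    and "\<And>k. x (Suc k) = inverse (\<psi> \<bullet> root_map d P (x k)) *\<^sub>R root_map d P (x k)"
  shows "(\<exists>!l. \<exists>u. pos_vec u \<and> eigenpair d P l u) \<and>
    (\<forall>l. (\<exists>u. pos_vec u \<and> eigenpair d P l u) \<longrightarrow>
      (\<exists>!u. pos_vec u \<and> eigenpair d P l u \<and> \<psi> \<bullet> u = 1) \<and>
      (\<forall>u. pos_vec u \<and> eigenpair d P l u \<and> \<psi> \<bullet> u = 1 \<longrightarrow> x \<longlonglongrightarrow> u))"
proof -
  let ?F = "root_map d P" and ?E = "{(i, j). appears_in j (P i)}"
  obtain N where N: "?E ^^ N = UNIV" using weakly_primitive_imp_relpow_UNIV[OF assms(4)] by blast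
  \<comment> \<open>Without cycles the gcd would be \<open>Gcd {} = 0\<close>. A cycle provides at
    least one arc.\<close>
  have "\<exists>c. pre_digraph.cycle (with_proj (poly_digraph P)) c"
  proof (rule ccontr)
    assume "\<not> ?thesis"
    then show False using assms(4) by (simp add: weakly_primitive_def)
  qed
  then obtain c where "c \<noteq> []" "set c \<subseteq> ?E"
    by (auto simp: pre_digraph.cycle_def pre_digraph.awalk_def poly_digraph_def)
  then obtain a b where ab: "(a, b) \<in> ?E" by (metis hd_in_set subsetD surj_pair)
  have vars: "\<exists>j. appears_in j (P i)" for i
  proof -
    \<comment> \<open>Length \<open>N + 1\<close> guarantees a first arc leaving \<open>i\<close>;
      \<open>N\<close> may be 0 when there is a single vertex.\<close>
    have "(i, b) \<in> ?E ^^ Suc N" using N ab by auto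
    then show ?thesis using relpow_Suc_D2 by fastforce
  qed
  interpret primitive_homogeneous_map ?F ?E N
    by (rule root_map_primitive_homogeneous[OF assms(1-3) N vars])
  have x_pos: "pos_vec (x k)" for k
    by (induction k) (auto simp: assms(6,7) pos inner_vec_pos[OF assms(5)] intro!: pos_vec_scaleR)
  have psi_F: "0 < \<psi> \<bullet> ?F (x k)" for k by (intro inner_vec_pos assms(5) pos x_pos)
  \<comment> \<open>The orbit is shifted by one because \<open>x 0\<close> need not satisfy the
    normalization.\<close>
  have "\<exists>u c. pos_vec u \<and> c > 0 \<and> ?F u = c *\<^sub>R u \<and> \<psi> \<bullet> u = 1 \<and> (\<lambda>k. x (Suc k)) \<longlonglongrightarrow> u"
  proof (rule normalized_orbit_converges[OF assms(5) x_pos])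
    show "\<psi> \<bullet> x (Suc k) = 1" for k using psi_F[of k] by (simp add: assms(7))
    show "\<exists>s>0. x (Suc (Suc k)) = s *\<^sub>R ?F (x (Suc k))" for k
      using assms(7)[of "Suc k"] psi_F[of "Suc k"] positive_imp_inverse_positive by blast
  qed
  then obtain u c where u: "pos_vec u" "c > 0" "?F u = c *\<^sub>R u" "\<psi> \<bullet> u = 1"
    and lim: "x \<longlonglongrightarrow> u"
    by (auto simp: filterlim_sequentially_Suc)
  note eig = eigenpair_iff_root_map[OF assms(1), of _ P]
  have c: "root d (c ^ d) = c" using assms(1) u(2) by (simp add: real_root_power_cancel)
  have eig_u: "eigenpair d P (c ^ d) u" using u c by (simp add: eig)
  \<comment> \<open>Taking roots makes \<open>v\<close> an eigenvector of the root map, so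
    uniqueness there fixes both \<open>l\<close> and the normalized vector.\<close>
  have val: "l = c ^ d" and vec: "\<psi> \<bullet> v = 1 \<Longrightarrow> v = u"
    if v: "pos_vec v" "eigenpair d P l v" for l v
  proof -
    have Fv: "?F v = root d l *\<^sub>R v" using v eig by blast
    then have "root d l = root d (c ^ d)" using eigenvector_unique(1)[OF v(1) _ u(1,3)] c by simp
    then show "l = c ^ d" using assms(1) by simp
    show "v = u" if "\<psi> \<bullet> v = 1"
      using eigenvector_unique(2)[OF v(1) Fv u(1,3) that u(4)] .
  qed
  show ?thesis
    using u(1,4) eig_u val vec lim by (intro conjI allI impI ex1I[of _ "c ^ d"] ex1I[of _ u]) blast+
qed

end
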